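(* Let $\mathcal{M}$ and $\mathcal{N}$ be two invariant subspaces of the Bergman shift $B$ with $\mathcal{M}\supsetneq\mathcal{N}$. Suppose that $\mathcal{N}\ominus B\mathcal{N}$ is finite dimensional and that $\dim(\mathcal{M}\ominus B\mathcal{M})=\infty$. Then there is an invariant subspace $\mathcal{L}$ of $B$ such that $$\mathcal{N}\subsetneq\mathcal{L}\subsetneq\mathcal{M}.$$
   Context: $H^2(\mathbb{T}^2)=H^2(\mathbb{T})\otimes H^2(\mathbb{T})$ is the Hardy space of the bidisc, with variables $z,w$, where $\mathbb{T}$ is the unit circle. Let $p_n(z,w)=\sum_{i=0}^{n}z^iw^{n-i}$ for $n\ge 0$, and let $\mathcal{H}$ be the closed linear span of $\{p_n\}_{n\ge0}$ in $H^2(\mathbb{T}^2)$; equivalently $\mathcal{H}=H^2(\mathbb{T}^2)\ominus[z-w]$, where $[z-w]$ is the closure of $(z-w)H^2(\mathbb{T}^2)$. Let $T_z,T_w$ be multiplication by $z$, $w$ on $H^2(\mathbb{T}^2)$, and let $P_{\mathcal{H}}$ be the orthogonal projection onto $\mathcal{H}$. The operator $B=P_{\mathcal{H}}T_z|_{\mathcal{H}}=P_{\mathcal{H}}T_w|_{\mathcal{H}}$ on $\mathcal{H}$ is unitarily equivalent to the Bergman shift (multiplication by the coordinate function on the Bergman space $L^2_a(\mathbb{D})$ of the unit disc) and is called the Bergman shift here. An invariant subspace of $B$ is a closed subspace $\mathcal{M}\subseteq\mathcal{H}$ with $B\mathcal{M}\subseteq\mathcal{M}$; $\mathcal{M}\ominus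 B\mathcal{M}=\mathcal{M}\cap(B\mathcal{M})^{\perp}$ is its wandering subspace. *)

theory Defs
  imports "HOL-Probability.Probability_Measure"
begin

section \<open>The torus and its normalised Lebesgue measure\<close>

definition circle_measure :: "complex measure" where
  "circle_measure =
     distr (uniform_measure lborel {0..<2 * pi}) (restrict_space borel (sphere 0 1)) cis"

definition torus_measure :: "(complex \<times> complex) measure" where
  "torus_measure = circle_measure \<Otimes>\<^sub>M circle_measure"

lemma space_torus: "space torus_measure = sphere 0 1 \<times> sphere 0 1"
  by (simp add: torus_measure_def circle_measure_def space_pair_measure space_restrict_space)

lemma prob_space_circle: "prob_space circle_measure"
proof -
  have "emeasure lborel {0..<2 * pi} \<noteq> 0"
    using pi_gt_zero by (simp add: ennreal_eq_0_iff not_le)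
  then interpret U: prob_space "uniform_measure lborel {0..<2 * pi}"
    by (intro prob_space_uniform_measure) auto
  have "cis \<in> borel_measurable borel"
    by (intro borel_measurable_continuous_onI continuous_intros)
  then have "cis \<in> uniform_measure lborel {0..<2 * pi} \<rightarrow>\<^sub>M restrict_space borel (sphere 0 1)"
    by (intro measurable_restrict_space2) (auto simp: measurable_def)
  then show ?thesis
    unfolding circle_measure_def by (rule U.prob_space_distr)
qed

lemma prob_space_torus: "prob_space torus_measure"
proof -
  interpret pair_prob_space circle_measure circle_measure
    using prob_space_circle by (simp add: pair_prob_space_def pair_sigma_finite_def
        prob_space_imp_sigma_finite)
  show ?thesis
    unfolding torus_measure_def by (rule P.prob_space_axioms)
qed

lemma measurable_torus_coords [measurable]:
  "fst \<in> borel_measurable torus_measure" "snd \<in> borel_measurable torus_measure"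
proof -
  have id: "(\<lambda>z. z) \<in> borel_measurable circle_measure"
    unfolding circle_measure_def by (simp add: measurable_restrict_space1)
  show "fst \<in> borel_measurable torus_measure"
    unfolding torus_measure_def by (rule measurable_compose[OF measurable_fst id])
  show "snd \<in> borel_measurable torus_measure"
    unfolding torus_measure_def by (rule measurable_compose[OF measurable_snd id])
qed

section \<open>The Hilbert space of square integrable functions on the torus\<close>

definition square_integrable :: "(complex \<times> complex \<Rightarrow> complex) \<Rightarrow> bool" where
  "square_integrable f \<longleftrightarrow>
     f \<in> borel_measurable torus_measure \<and> integrable torus_measure (\<lambda>x. (cmod (f x))\<^sup>2)"

lemma square_integrable_mult:
  assumes "square_integrable f" "square_integrable g"
  shows "integrable torus_measure (\<lambda>x. f x * cnj (g x))"
proof (rule Bochner_Integration.integrable_bound)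
  show "integrable torus_measure (\<lambda>x. (cmod (f x))\<^sup>2 + (cmod (g x))\<^sup>2)"
    using assms by (auto simp: square_integrable_def)
  have [measurable]: "f \<in> borel_measurable torus_measure" "g \<in> borel_measurable torus_measure"
    using assms by (auto simp: square_integrable_def)
  show "(\<lambda>x. f x * cnj (g x)) \<in> borel_measurable torus_measure"
    by (intro borel_measurable_times
        borel_measurable_continuous_on[OF continuous_on_cnj[OF continuous_on_id], where g = g]) fact+
  have "a * b \<le> a\<^sup>2 + b\<^sup>2" if "0 \<le> a" "0 \<le> b" for a b :: real
  proof -
    have "2 * (a * b) \<le> a\<^sup>2 + b\<^sup>2"
      using sum_squares_bound[of a b] by (simp add: mult.assoc)
    moreover have "0 \<le> a * b"
      using that by simp
    ultimately show ?thesis by linarith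
  qed
  then show "AE x in torus_measure.
      norm (f x * cnj (g x)) \<le> norm ((cmod (f x))\<^sup>2 + (cmod (g x))\<^sup>2)"
    by (simp add: norm_mult)
qed

lemma square_integrable_add:
  assumes "square_integrable f" "square_integrable g"
  shows "square_integrable (\<lambda>x. f x + g x)"
  unfolding square_integrable_def
proof
  have [measurable]: "f \<in> borel_measurable torus_measure" "g \<in> borel_measurable torus_measure"
    using assms by (auto simp: square_integrable_def)
  show "(\<lambda>x. f x + g x) \<in> borel_measurable torus_measure"
    by measurable
  show "integrable torus_measure (\<lambda>x. (cmod (f x + g x))\<^sup>2)"
  proof (rule Bochner_Integration.integrable_bound)
    show "integrable torus_measure (\<lambda>x. 2 * (cmod (f x))\<^sup>2 + 2 * (cmod (g x))\<^sup>2)"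
      using assms by (auto simp: square_integrable_def)
    have "(cmod (a + b))\<^sup>2 \<le> 2 * (cmod a)\<^sup>2 + 2 * (cmod b)\<^sup>2" for a b
    proof -
      have "(cmod (a + b))\<^sup>2 \<le> (cmod a + cmod b)\<^sup>2"
        by (intro power_mono norm_triangle_ineq) auto
      also have "\<dots> \<le> 2 * (cmod a)\<^sup>2 + 2 * (cmod b)\<^sup>2"
        using sum_squares_bound[of "cmod a" "cmod b"] by (simp add: power2_sum)
      finally show ?thesis .
    qed
    then show "AE x in torus_measure. norm ((cmod (f x + g x))\<^sup>2)
                 \<le> norm (2 * (cmod (f x))\<^sup>2 + 2 * (cmod (g x))\<^sup>2)"
      by simp
  qed measurable
qed

lemma square_integrable_times_bounded:
  assumes f: "square_integrable f" and h [measurable]: "h \<in> borel_measurable torus_measure"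
    and bound: "\<And>x. x \<in> space torus_measure \<Longrightarrow> cmod (h x) \<le> C"
  shows "square_integrable (\<lambda>x. h x * f x)"
  unfolding square_integrable_def
proof
  have [measurable]: "f \<in> borel_measurable torus_measure"
    using f by (auto simp: square_integrable_def)
  show "(\<lambda>x. h x * f x) \<in> borel_measurable torus_measure"
    by measurable
  show "integrable torus_measure (\<lambda>x. (cmod (h x * f x))\<^sup>2)"
  proof (rule Bochner_Integration.integrable_bound)
    show "integrable torus_measure (\<lambda>x. C\<^sup>2 * (cmod (f x))\<^sup>2)"
      using f by (auto simp: square_integrable_def)
    show "AE x in torus_measure. norm ((cmod (h x * f x))\<^sup>2) \<le> norm (C\<^sup>2 * (cmod (f x))\<^sup>2)"
      using bound by (auto intro!: mult_right_mono power_mono simp: norm_mult power_mult_distrib)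
  qed measurable
qed

lemma square_integrable_scale:
  "square_integrable f \<Longrightarrow> square_integrable (\<lambda>x. c * f x)"
  by (rule square_integrable_times_bounded[where C = "cmod c"]) auto

lemma square_integrable_one: "square_integrable (\<lambda>x. 1)"
proof -
  interpret prob_space torus_measure by (rule prob_space_torus)
  show ?thesis by (simp add: square_integrable_def)
qed

definition square_integrable_eq ::
    "(complex \<times> complex \<Rightarrow> complex) \<Rightarrow> (complex \<times> complex \<Rightarrow> complex) \<Rightarrow> bool" where
  "square_integrable_eq f g \<longleftrightarrow>
     square_integrable f \<and> square_integrable g \<and> (AE x in torus_measure. f x = g x)"

quotient_type torus_L2 = "complex \<times> complex \<Rightarrow> complex" / partial: square_integrable_eq
proof (rule part_equivpI)
  show "\<exists>f. square_integrable_eq f f"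
    using square_integrable_one by (auto simp: square_integrable_eq_def)
  show "symp square_integrable_eq"
    by (auto simp: symp_def square_integrable_eq_def)
  show "transp square_integrable_eq"
    by (auto simp: transp_def square_integrable_eq_def)
qed

lift_definition scaleC :: "complex \<Rightarrow> torus_L2 \<Rightarrow> torus_L2" (infixr "*\<^sub>C" 75)
  is "\<lambda>c f x. c * f x"
  by (auto simp: square_integrable_eq_def square_integrable_scale)

lift_definition cinner :: "torus_L2 \<Rightarrow> torus_L2 \<Rightarrow> complex"
  is "\<lambda>f g. LINT x|torus_measure. f x * cnj (g x)"
  unfolding square_integrable_eq_def
  by (rule integral_cong_AE) (auto intro: borel_measurable_integrable square_integrable_mult)

instantiation torus_L2 :: real_vector
begin

lift_definition zero_torus_L2 :: torus_L2 is "\<lambda>x. 0"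
  by (simp add: square_integrable_eq_def square_integrable_def)

lift_definition plus_torus_L2 :: "torus_L2 \<Rightarrow> torus_L2 \<Rightarrow> torus_L2" is "\<lambda>f g x. f x + g x"
  by (auto simp: square_integrable_eq_def square_integrable_add)

definition "(- f :: torus_L2) = (-1) *\<^sub>C f"

definition "(f - g :: torus_L2) = f + (- g)"

definition "r *\<^sub>R (f :: torus_L2) = complex_of_real r *\<^sub>C f"

instance
proof
  fix f g h :: torus_L2 and a b :: real
  show "f + g + h = f + (g + h)"
    by transfer (auto simp: square_integrable_eq_def algebra_simps square_integrable_add)
  show "f + g = g + f"
    by transfer (auto simp: square_integrable_eq_def algebra_simps square_integrable_add)
  show "0 + f = f"
    by transfer (auto simp: square_integrable_eq_def)
  show "- f + f = 0"
    unfolding uminus_torus_L2_def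
    by transfer (auto simp: square_integrable_eq_def square_integrable_def)
  show "f - g = f + - g"
    by (simp add: minus_torus_L2_def)
  show "a *\<^sub>R (f + g) = a *\<^sub>R f + a *\<^sub>R g"
    unfolding scaleR_torus_L2_def
    by transfer (auto simp: square_integrable_eq_def distrib_left
        intro!: square_integrable_add square_integrable_scale)
  show "(a + b) *\<^sub>R f = a *\<^sub>R f + b *\<^sub>R f"
    unfolding scaleR_torus_L2_def
    by transfer (auto simp: square_integrable_eq_def distrib_right
        intro!: square_integrable_add square_integrable_scale)
  show "a *\<^sub>R b *\<^sub>R f = (a * b) *\<^sub>R f"
    unfolding scaleR_torus_L2_def
    by transfer (auto simp: square_integrable_eq_def mult.assoc intro!: square_integrable_scale)
  show "1 *\<^sub>R f = f"
    unfolding scaleR_torus_L2_def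
    by transfer (auto simp: square_integrable_eq_def)
qed

end

global_interpretation cvec: vector_space scaleC
  defines cspan = cvec.span and csubspace = cvec.subspace
proof
  fix a b :: complex and f g :: torus_L2
  show "a *\<^sub>C (f + g) = a *\<^sub>C f + a *\<^sub>C g"
    by transfer (auto simp: square_integrable_eq_def distrib_left
        intro!: square_integrable_add square_integrable_scale)
  show "(a + b) *\<^sub>C f = a *\<^sub>C f + b *\<^sub>C f"
    by transfer (auto simp: square_integrable_eq_def distrib_right
        intro!: square_integrable_add square_integrable_scale)
  show "a *\<^sub>C b *\<^sub>C f = (a * b) *\<^sub>C f"
    by transfer (auto simp: square_integrable_eq_def mult.assoc intro!: square_integrable_scale)
  show "1 *\<^sub>C f = f"
    by transfer (auto simp: square_integrable_eq_def)
qed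

text \<open>The norm, and with it the topology of \<^typ>\<open>torus_L2\<close>, comes from the real inner product
  \<open>Re \<langle>f, g\<rangle>\<close>, which induces the same norm as the complex one.\<close>

instantiation torus_L2 :: real_inner
begin

definition "inner (f :: torus_L2) g = Re (cinner f g)"

definition "norm (f :: torus_L2) = sqrt (inner f f)"

definition "dist (f :: torus_L2) g = norm (f - g)"

definition "sgn (f :: torus_L2) = f /\<^sub>R norm f"

definition [code del]:
  "(uniformity :: (torus_L2 \<times> torus_L2) filter) =
     (INF e\<in>{0<..}. principal {(f, g). dist f g < e})"

definition [code del]:
  "open (U :: torus_L2 set) \<longleftrightarrow> (\<forall>f\<in>U. eventually (\<lambda>(f', g). f' = f \<longrightarrow> g \<in> U) uniformity)"

instance
proof
  fix f g h :: torus_L2 and r :: real and U :: "torus_L2 set"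
  show "dist f g = norm (f - g)"
    by (rule dist_torus_L2_def)
  show "sgn f = f /\<^sub>R norm f"
    by (rule sgn_torus_L2_def)
  show "uniformity = (INF e\<in>{0<..}. principal {(f :: torus_L2, g). dist f g < e})"
    by (rule uniformity_torus_L2_def)
  show "open U \<longleftrightarrow> (\<forall>f\<in>U. eventually (\<lambda>(f', g). f' = f \<longrightarrow> g \<in> U) uniformity)"
    by (rule open_torus_L2_def)
  show "norm f = sqrt (inner f f)"
    by (rule norm_torus_L2_def)
  have cnj: "cinner f g = cnj (cinner g f)"
    by transfer (simp add: mult.commute flip: Bochner_Integration.integral_cnj)
  show "inner f g = inner g f"
    unfolding inner_torus_L2_def by (subst cnj) simp
  have "cinner (f + g) h = cinner f h + cinner g h"
    by transfer (simp add: square_integrable_eq_def distrib_right square_integrable_mult)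
  then show "inner (f + g) h = inner f h + inner g h"
    by (simp add: inner_torus_L2_def)
  have "cinner (complex_of_real r *\<^sub>C f) g = complex_of_real r * cinner f g"
    by transfer (simp add: mult.assoc)
  then show "inner (r *\<^sub>R f) g = r * inner f g"
    by (simp add: inner_torus_L2_def scaleR_torus_L2_def)
  have sq: "Re (cinner f f) \<ge> 0 \<and> (Re (cinner f f) = 0 \<longleftrightarrow> f = 0)"
  proof (transfer, goal_cases)
    case (1 f)
    have f: "square_integrable f"
      using 1 by (simp add: square_integrable_eq_def)
    have eq: "(LINT x|torus_measure. f x * cnj (f x))
        = complex_of_real (LINT x|torus_measure. (cmod (f x))\<^sup>2)"
      by (simp flip: complex_norm_square integral_complex_of_real)
    have int: "integrable torus_measure (\<lambda>x. (cmod (f x))\<^sup>2)"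
      using f by (simp add: square_integrable_def)
    have "square_integrable (\<lambda>x. 0)"
      by (simp add: square_integrable_def)
    with f show ?case
      unfolding eq Re_complex_of_real using integral_nonneg_eq_0_iff_AE[OF int]
      by (auto simp: square_integrable_eq_def)
  qed
  show "inner f f \<ge> 0" "inner f f = 0 \<longleftrightarrow> f = 0"
    using sq by (auto simp: inner_torus_L2_def)
qed

end

section \<open>Orthogonality and dimension\<close>

definition ominus :: "torus_L2 set \<Rightarrow> torus_L2 set \<Rightarrow> torus_L2 set" (infixl "\<ominus>" 65) where
  "S \<ominus> T = {f \<in> S. \<forall>g\<in>T. cinner f g = 0}"

text \<open>Used only for closed complex subspaces \<open>S\<close>, where the projection of every \<open>f\<close> exists and
  is unique.\<close>

definition orth_proj :: "torus_L2 set \<Rightarrow> torus_L2 \<Rightarrow> torus_L2" where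
  "orth_proj S f = (THE g. g \<in> S \<and> (\<forall>h\<in>S. cinner (f - g) h = 0))"

definition cfinite_dimensional :: "torus_L2 set \<Rightarrow> bool" where
  "cfinite_dimensional S \<longleftrightarrow> (\<exists>b. finite b \<and> S \<subseteq> cspan b)"

section \<open>The Hardy space of the bidisc and the Bergman shift\<close>

lift_definition monomial :: "nat \<Rightarrow> nat \<Rightarrow> torus_L2" is "\<lambda>i j x. fst x ^ i * snd x ^ j"
proof -
  fix i j
  have "square_integrable (\<lambda>x. (fst x ^ i * snd x ^ j) * 1)"
    by (rule square_integrable_times_bounded[OF square_integrable_one, where C = 1])
      (auto simp: space_torus norm_mult norm_power)
  then show "square_integrable_eq (\<lambda>x. fst x ^ i * snd x ^ j) (\<lambda>x. fst x ^ i * snd x ^ j)"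
    by (simp add: square_integrable_eq_def)
qed

lift_definition T_z :: "torus_L2 \<Rightarrow> torus_L2" is "\<lambda>f x. fst x * f x"
proof -
  fix f g
  assume fg: "square_integrable_eq f g"
  have "square_integrable (\<lambda>x. fst x * h x)" if "square_integrable h" for h
    by (rule square_integrable_times_bounded[OF that, where C = 1]) (auto simp: space_torus)
  with fg show "square_integrable_eq (\<lambda>x. fst x * f x) (\<lambda>x. fst x * g x)"
    by (auto simp: square_integrable_eq_def)
qed

text \<open>As a subspace of \<open>L\<^sup>2(\<T>\<^sup>2)\<close>, the Hilbert space tensor product \<open>H\<^sup>2(\<T>) \<otimes> H\<^sup>2(\<T>)\<close> is the
  closure of the analytic polynomials.\<close>

definition Hardy_space :: "torus_L2 set" where
  "Hardy_space = closure (cspan (range (\<lambda>(i, j). monomial i j)))"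

definition p_poly :: "nat \<Rightarrow> torus_L2" where
  "p_poly n = (\<Sum>i\<le>n. monomial i (n - i))"

definition H_space :: "torus_L2 set" where
  "H_space = closure (cspan (range p_poly))"

lemma H_space_subset_Hardy_space: "H_space \<subseteq> Hardy_space"
proof -
  have "p_poly n \<in> cspan (range (\<lambda>(i, j). monomial i j))" for n
    unfolding p_poly_def by (intro cvec.span_sum cvec.span_base) auto
  then have "cspan (range p_poly) \<subseteq> cspan (range (\<lambda>(i, j). monomial i j))"
    by (intro cvec.span_minimal cvec.subspace_span) auto
  then show ?thesis
    unfolding H_space_def Hardy_space_def by (rule closure_mono)
qed

definition Bergman_shift :: "torus_L2 \<Rightarrow> torus_L2" where
  "Bergman_shift f = orth_proj H_space (T_z f)"

definition Bergman_invariant :: "torus_L2 set \<Rightarrow> bool" where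
  "Bergman_invariant M \<longleftrightarrow>
     csubspace M \<and> closed M \<and> M \<subseteq> H_space \<and> Bergman_shift ` M \<subseteq> M"

end

theory Submission
  imports Defs
begin

text \<open>
  The wandering subspace \<open>E = M \<ominus> B M\<close> parametrises invariant subspaces just below \<open>M\<close>: for any
  \<open>g \<in> E\<close>, the set \<open>L = {f \<in> M. f \<bottom> g}\<close> contains \<open>B M\<close>, hence \<open>B L \<subseteq> B M \<subseteq> L\<close>
  (\<open>Bergman_invariant_orthogonal\<close>). It contains \<open>N\<close> precisely when \<open>g \<bottom> N\<close>.

  For \<open>g \<in> E\<close> this last condition amounts to only finitely many linear equations. Indeed \<open>g\<close> is
  orthogonal to \<open>B M\<close> and so to \<open>B N\<close>; its projection \<open>n\<close> onto \<open>N\<close> therefore lies in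
  \<open>N \<ominus> B N\<close>. If \<open>g\<close> is orthogonal to a finite set spanning \<open>N \<ominus> B N\<close>, then
  \<open>\<langle>n, n\<rangle> = \<langle>g, n\<rangle> = 0\<close>, so \<open>n = 0\<close> and \<open>g \<bottom> N\<close> (\<open>orthogonal_if_orthogonal_ominus\<close>).

  Since \<open>E\<close> is infinite dimensional, finitely many equations leave room for two nonzero, mutually
  orthogonal vectors \<open>g1, g2 \<in> E\<close> that are both orthogonal to \<open>N\<close>
  (\<open>exists_nonzero_orthogonal\<close>). With \<open>L = {f \<in> M. f \<bottom> g1}\<close> the vector \<open>g1\<close> witnesses
  \<open>L \<noteq> M\<close> and \<open>g2\<close> witnesses \<open>L \<noteq> N\<close>.

  The analytic input is the existence of the projection onto the closed subspace \<open>N\<close>, which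
  rests on the completeness of \<open>L\<^sup>2\<close> of the torus (the Riesz--Fischer theorem).
\<close>

section \<open>Completeness of the space of square integrable functions\<close>

lemma square_integrable_eq_refl:
  "square_integrable f \<Longrightarrow> square_integrable_eq f f"
  by (simp add: square_integrable_eq_def)

lemma torus_L2_obtain_rep:
  obtains f where "square_integrable f" "F = abs_torus_L2 f"
  using Quotient_rep_reflp[OF Quotient_torus_L2, of F] Quotient_abs_rep[OF Quotient_torus_L2, of F]
  by (metis square_integrable_eq_def)

lemma square_integrable_diff:
  assumes "square_integrable f" "square_integrable g"
  shows "square_integrable (\<lambda>x. f x - g x)"
  using square_integrable_add[OF assms(1) square_integrable_scale[OF assms(2), of "-1"]] by simp

lemma abs_torus_L2_diff:
  assumes "square_integrable f" "square_integrable g"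
  shows "abs_torus_L2 f - abs_torus_L2 g = abs_torus_L2 (\<lambda>x. f x - g x)"
proof -
  have "square_integrable (\<lambda>x. (-1) * g x)"
    using assms(2) by (rule square_integrable_scale)
  then have "abs_torus_L2 f + (-1) *\<^sub>C abs_torus_L2 g = abs_torus_L2 (\<lambda>x. f x + (-1) * g x)"
    using assms by (simp only: scaleC.abs_eq plus_torus_L2.abs_eq square_integrable_eq_refl)
  moreover have "(\<lambda>x. f x + (-1) * g x) = (\<lambda>x. f x - g x)"
    by simp
  ultimately show ?thesis
    unfolding minus_torus_L2_def uminus_torus_L2_def by (simp only:)
qed

lemma norm_abs_torus_L2:
  assumes "square_integrable f"
  shows "(norm (abs_torus_L2 f))\<^sup>2 = (LINT x|torus_measure. (cmod (f x))\<^sup>2)"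
proof -
  have "cinner (abs_torus_L2 f) (abs_torus_L2 f)
      = complex_of_real (LINT x|torus_measure. (cmod (f x))\<^sup>2)"
    using assms by (simp add: cinner.abs_eq square_integrable_eq_refl
        flip: complex_norm_square integral_complex_of_real)
  then have "inner (abs_torus_L2 f) (abs_torus_L2 f) = (LINT x|torus_measure. (cmod (f x))\<^sup>2)"
    by (simp add: inner_torus_L2_def)
  then show ?thesis
    by (simp add: power2_norm_eq_inner)
qed

lemma nn_integral_diff_square:
  assumes "square_integrable f" "square_integrable g"
  shows "(\<integral>\<^sup>+x. ennreal ((cmod (f x - g x))\<^sup>2) \<partial>torus_measure)
    = ennreal ((dist (abs_torus_L2 f) (abs_torus_L2 g))\<^sup>2)"
proof -
  have fg: "square_integrable (\<lambda>x. f x - g x)"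
    using assms by (rule square_integrable_diff)
  then have "integrable torus_measure (\<lambda>x. (cmod (f x - g x))\<^sup>2)"
    by (simp add: square_integrable_def)
  then show ?thesis
    using norm_abs_torus_L2[OF fg] assms
    by (simp add: nn_integral_eq_integral dist_norm abs_torus_L2_diff)
qed

text \<open>The torus has measure one, so the \<open>L\<^sup>1\<close> norm is controlled by the \<open>L\<^sup>2\<close> norm; the constant
  \<open>2\<close>, weaker than the one of Cauchy--Schwarz, comes from integrating the pointwise bound
  \<open>a \<le> t + a\<^sup>2 / t\<close>.\<close>

lemma nn_integral_diff_le:
  assumes f: "square_integrable f" and g: "square_integrable g"
    and "dist (abs_torus_L2 f) (abs_torus_L2 g) \<le> t" "0 < t"
  shows "(\<integral>\<^sup>+x. ennreal (cmod (f x - g x)) \<partial>torus_measure) \<le> ennreal (2 * t)"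
proof -
  interpret prob_space torus_measure by (rule prob_space_torus)
  have [measurable]: "f \<in> borel_measurable torus_measure" "g \<in> borel_measurable torus_measure"
    using assms by (auto simp: square_integrable_def)
  have le: "a \<le> t + (1 / t) * a\<^sup>2" if "0 \<le> a" for a :: real
  proof -
    have "a * t \<le> t\<^sup>2 + a\<^sup>2"
    proof -
      have "2 * (a * t) \<le> a\<^sup>2 + t\<^sup>2"
        using sum_squares_bound[of a t] by (simp only: mult.assoc)
      moreover have "0 \<le> a * t"
        using that \<open>0 < t\<close> by simp
      ultimately show ?thesis
        by linarith
    qed
    then have "a * t / t \<le> (t\<^sup>2 + a\<^sup>2) / t"
      using \<open>0 < t\<close> by (intro divide_right_mono) auto
    then show ?thesis
      using \<open>0 < t\<close> by (simp add: add_divide_distrib power2_eq_square)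
  qed
  have "(\<integral>\<^sup>+x. ennreal (cmod (f x - g x)) \<partial>torus_measure)
      \<le> (\<integral>\<^sup>+x. (ennreal t + ennreal (1 / t) * ennreal ((cmod (f x - g x))\<^sup>2)) \<partial>torus_measure)"
    using \<open>0 < t\<close> le
    by (intro nn_integral_mono) (simp flip: ennreal_mult' ennreal_plus)
  also have "\<dots> = ennreal t + ennreal (1 / t) * ennreal ((dist (abs_torus_L2 f) (abs_torus_L2 g))\<^sup>2)"
    by (simp add: nn_integral_add nn_integral_cmult emeasure_space_1
        nn_integral_diff_square[OF f g])
  also have "\<dots> \<le> ennreal t + ennreal (1 / t) * ennreal (t\<^sup>2)"
    using assms by (intro add_left_mono mult_left_mono ennreal_leI power_mono) auto
  also have "\<dots> = ennreal (2 * t)"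
    using \<open>0 < t\<close> by (simp add: power2_eq_square flip: ennreal_mult' ennreal_plus)
  finally show ?thesis .
qed

text \<open>The increments have summable \<open>L\<^sup>1\<close> norms, so by monotone convergence they are absolutely
  summable at almost every point.\<close>

lemma AE_convergent_fast_Cauchy:
  assumes f: "\<And>n. square_integrable (f n)"
    and fast: "\<And>n. dist (abs_torus_L2 (f (Suc n))) (abs_torus_L2 (f n)) \<le> (1 / 2) ^ n"
  shows "AE x in torus_measure. convergent (\<lambda>n. f n x)"
proof -
  have [measurable]: "f n \<in> borel_measurable torus_measure" for n
    using f by (auto simp: square_integrable_def)
  let ?h = "\<lambda>n x. cmod (f (Suc n) x - f n x)"
  have "(\<integral>\<^sup>+x. (\<Sum>n. ennreal (?h n x)) \<partial>torus_measure)
      = (\<Sum>n. \<integral>\<^sup>+x. ennreal (?h n x) \<partial>torus_measure)"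
    by (rule nn_integral_suminf) measurable
  also have "\<dots> \<le> (\<Sum>n. ennreal (2 * (1 / 2) ^ n))"
    using f fast by (intro suminf_le nn_integral_diff_le) auto
  also have "\<dots> < top"
  proof -
    have "summable (\<lambda>n. 2 * (1 / 2 :: real) ^ n)"
      by (intro summable_mult summable_geometric) simp
    then have "(\<Sum>n. ennreal (2 * (1 / 2) ^ n)) \<noteq> top"
      by (rule ennreal_suminf_neq_top) simp
    then show ?thesis
      unfolding less_top .
  qed
  finally have "AE x in torus_measure. (\<Sum>n. ennreal (?h n x)) \<noteq> \<infinity>"
    by (intro nn_integral_PInf_AE) auto
  then show ?thesis
  proof eventually_elim
    case (elim x)
    then have "summable (\<lambda>n. ?h n x)"
      by (intro summable_suminf_not_top) auto
    then have "summable (\<lambda>n. f (Suc n) x - f n x)"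
      by (rule summable_norm_cancel)
    then have "convergent (\<lambda>n. f n x - f 0 x)"
      unfolding summable_iff_convergent sum_lessThan_telescope[of "\<lambda>n. f n x"] .
    from convergent_add[OF this convergent_const[of "f 0 x"]] show ?case
      by simp
  qed
qed

text \<open>Riesz--Fischer: a sufficiently fast subsequence converges almost everywhere, and Fatou's lemma
  shows that its pointwise limit is also the limit of the whole sequence in norm.\<close>

instance torus_L2 :: complete_space
proof
  fix X :: "nat \<Rightarrow> torus_L2"
  assume "Cauchy X"
  then have "\<exists>K. \<forall>i\<ge>K. \<forall>j\<ge>K. dist (X i) (X j) < (1 / 2) ^ n" for n
    by (intro metric_CauchyD) auto
  then obtain K where K: "\<And>n i j. K n \<le> i \<Longrightarrow> K n \<le> j \<Longrightarrow> dist (X i) (X j) < (1 / 2) ^ n"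
    by metis
  \<comment> \<open>The sum turns the thresholds \<open>K n\<close> into thresholds increasing with \<open>n\<close>.\<close>
  define r where "r n = (\<Sum>i\<le>n. K i)" for n
  have K_le: "K n \<le> r n" for n
    unfolding r_def by (rule member_le_sum) auto
  have r_mono: "r m \<le> r n" if "m \<le> n" for m n
    unfolding r_def using that by (intro sum_mono2) auto
  have "\<forall>n. \<exists>f. square_integrable f \<and> X n = abs_torus_L2 f"
    using torus_L2_obtain_rep by metis
  then obtain f where f: "\<And>n. square_integrable (f n)" and X: "\<And>n. X n = abs_torus_L2 (f n)"
    by metis
  have [measurable]: "f n \<in> borel_measurable torus_measure" for n
    using f by (auto simp: square_integrable_def)
  have "AE x in torus_measure. convergent (\<lambda>n. f (r n) x)"
  proof (rule AE_convergent_fast_Cauchy)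
    show "dist (abs_torus_L2 (f (r (Suc n)))) (abs_torus_L2 (f (r n))) \<le> (1 / 2) ^ n" for n
      using K[of n "r (Suc n)" "r n"] K_le[of n] r_mono[of n "Suc n"] by (simp add: X)
  qed (rule f)
  define F where "F x = lim (\<lambda>n. f (r n) x)" for x
  have [measurable]: "F \<in> borel_measurable torus_measure"
    unfolding F_def by measurable
  have lim: "AE x in torus_measure. (\<lambda>n. f (r n) x) \<longlonglongrightarrow> F x"
    using \<open>AE x in torus_measure. convergent _\<close>
    by eventually_elim (simp add: F_def convergent_LIMSEQ_iff)
  have Fatou: "(\<integral>\<^sup>+x. ennreal ((cmod (f i x - F x))\<^sup>2) \<partial>torus_measure) \<le> ennreal (((1 / 2) ^ n)\<^sup>2)"
    if "r n \<le> i" for n i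
  proof -
    have "AE x in torus_measure. ennreal ((cmod (f i x - F x))\<^sup>2)
        = liminf (\<lambda>m. ennreal ((cmod (f i x - f (r m) x))\<^sup>2))"
      using lim
    proof eventually_elim
      case (elim x)
      then have "(\<lambda>m. ennreal ((cmod (f i x - f (r m) x))\<^sup>2)) \<longlonglongrightarrow> ennreal ((cmod (f i x - F x))\<^sup>2)"
        by (intro tendsto_intros tendsto_ennrealI)
      from lim_imp_Liminf[OF _ this] show ?case
        by simp
    qed
    then have "(\<integral>\<^sup>+x. ennreal ((cmod (f i x - F x))\<^sup>2) \<partial>torus_measure)
        = (\<integral>\<^sup>+x. liminf (\<lambda>m. ennreal ((cmod (f i x - f (r m) x))\<^sup>2)) \<partial>torus_measure)"
      by (rule nn_integral_cong_AE)
    also have "\<dots> \<le> liminf (\<lambda>m. \<integral>\<^sup>+x. ennreal ((cmod (f i x - f (r m) x))\<^sup>2) \<partial>torus_measure)"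
      by (rule nn_integral_liminf) measurable
    also have "\<dots> = liminf (\<lambda>m. ennreal ((dist (X i) (X (r m)))\<^sup>2))"
      by (simp add: nn_integral_diff_square f X)
    also have "\<dots> \<le> liminf (\<lambda>m. ennreal (((1 / 2) ^ n)\<^sup>2))"
    proof (rule Liminf_mono, rule eventually_sequentiallyI[of n])
      fix m
      assume "n \<le> m"
      then have "dist (X i) (X (r m)) < (1 / 2) ^ n"
        using K_le[of n] r_mono[of n m] that by (intro K) auto
      then show "ennreal ((dist (X i) (X (r m)))\<^sup>2) \<le> ennreal (((1 / 2) ^ n)\<^sup>2)"
        by (intro ennreal_leI power_mono) auto
    qed
    also have "\<dots> = ennreal (((1 / 2) ^ n)\<^sup>2)"
      by (simp add: Liminf_const)
    finally show ?thesis .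
  qed
  \<comment> \<open>Square integrability of \<open>F\<close> is read off from the bound on its distance to one \<open>f i\<close>.\<close>
  have "integrable torus_measure (\<lambda>x. (cmod (f (r 0) x - F x))\<^sup>2)"
    using Fatou[of 0 "r 0"] by (intro integrableI_bounded) (auto intro: le_less_trans)
  then have "square_integrable (\<lambda>x. f (r 0) x - F x)"
    by (simp add: square_integrable_def)
  from square_integrable_diff[OF f[of "r 0"] this] have F: "square_integrable F"
    by simp
  have dist_F: "dist (X i) (abs_torus_L2 F) \<le> (1 / 2) ^ n" if "r n \<le> i" for n i
  proof -
    have "(dist (X i) (abs_torus_L2 F))\<^sup>2 \<le> ((1 / 2) ^ n)\<^sup>2"
      using Fatou[OF that] by (simp add: nn_integral_diff_square[OF f F] X)
    then show ?thesis
      by (rule power2_le_imp_le) simp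
  qed
  have "X \<longlonglongrightarrow> abs_torus_L2 F"
  proof (rule metric_LIMSEQ_I)
    fix e :: real
    assume "0 < e"
    then obtain n where "(1 / 2) ^ n < e"
      using real_arch_pow_inv[of e "1 / 2"] by auto
    then show "\<exists>i0. \<forall>i\<ge>i0. dist (X i) (abs_torus_L2 F) < e"
      using dist_F by (meson le_less_trans)
  qed
  then show "convergent X"
    by (auto simp: convergent_def)
qed

section \<open>Orthogonality\<close>

lemma cinner_add_left: "cinner (f + g) h = cinner f h + cinner g h"
  by transfer (simp add: square_integrable_eq_def distrib_right square_integrable_mult)

lemma cinner_scaleC_left: "cinner (c *\<^sub>C f) g = c * cinner f g"
  by transfer (simp add: mult.assoc)

lemma cinner_commute: "cinner f g = cnj (cinner g f)"
  by transfer (simp add: mult.commute flip: Bochner_Integration.integral_cnj)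

lemma cinner_scaleC_right: "cinner f (c *\<^sub>C g) = cnj c * cinner f g"
proof -
  have "cinner f (c *\<^sub>C g) = cnj (c * cinner g f)"
    using cinner_commute[of f "c *\<^sub>C g"] by (simp only: cinner_scaleC_left)
  also have "\<dots> = cnj c * cinner f g"
    using cinner_commute[of f g] by (simp only: complex_cnj_mult)
  finally show ?thesis .
qed

lemma cinner_zero_left [simp]: "cinner 0 f = 0"
  by transfer simp

lemma cinner_diff_left: "cinner (f - g) h = cinner f h - cinner g h"
  unfolding minus_torus_L2_def uminus_torus_L2_def cinner_add_left cinner_scaleC_left by simp

lemma cinner_eq_zero_commute: "cinner f g = 0 \<longleftrightarrow> cinner g f = 0"
  by (subst cinner_commute) (simp only: complex_cnj_zero_iff)

lemma cinner_self_eq_zero: "cinner f f = 0 \<longleftrightarrow> f = 0"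
  using inner_eq_zero_iff[of f] by (auto simp: inner_torus_L2_def)

lemma csubspace_imp_subspace: "csubspace S \<Longrightarrow> subspace S"
  by (auto simp: subspace_def cvec.subspace_def scaleR_torus_L2_def)

lemma csubspace_orthogonal: "csubspace {f. cinner f g = 0}"
  by (auto simp: cvec.subspace_def cinner_add_left cinner_scaleC_left)

lemma closed_orthogonal: "closed {f. cinner f g = 0}"
proof -
  have "{f. cinner f g = 0} = {f. inner f g = 0} \<inter> {f. inner f (\<i> *\<^sub>C g) = 0}"
    by (auto simp: complex_eq_iff inner_torus_L2_def cinner_scaleC_right)
  moreover have "closed {f. inner f h = 0}" for h :: torus_L2
    by (intro closed_Collect_eq continuous_intros)
  ultimately show ?thesis
    by (simp add: closed_Int)
qed

text \<open>A minimising sequence is Cauchy: by the parallelogram law, two points of \<open>S\<close> that almost attain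
  the distance \<open>d\<close> from \<open>x\<close> to \<open>S\<close> are close to each other, because their midpoint is in \<open>S\<close> and so
  no nearer to \<open>x\<close> than \<open>d\<close>.\<close>

lemma exists_closest_point:
  fixes S :: "'a :: {real_inner, complete_space} set"
  assumes S: "subspace S" "closed S"
  shows "\<exists>y\<in>S. \<forall>z\<in>S. dist x y \<le> dist x z"
proof -
  have ne: "S \<noteq> {}"
    using S(1) subspace_0 by blast
  define d where "d = infdist x S"
  have d_le: "d \<le> dist x z" if "z \<in> S" for z
    using that unfolding d_def by (rule infdist_le)
  have d0: "0 \<le> d"
    unfolding d_def by (rule infdist_nonneg)
  have "\<exists>y\<in>S. (dist x y)\<^sup>2 < d\<^sup>2 + 1 / real (Suc n)" for n
  proof -
    have "d < sqrt (d\<^sup>2 + 1 / real (Suc n))"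
      using d0 by (intro real_less_rsqrt) simp
    then obtain y where y: "y \<in> S" "dist x y < sqrt (d\<^sup>2 + 1 / real (Suc n))"
      unfolding d_def infdist_notempty[OF ne] by (subst (asm) cINF_less_iff) (auto simp: ne)
    then have "(dist x y)\<^sup>2 < (sqrt (d\<^sup>2 + 1 / real (Suc n)))\<^sup>2"
      by (intro power_strict_mono) auto
    with y show ?thesis
      by (auto simp: add_nonneg_nonneg)
  qed
  then obtain Y where Y: "\<And>n. Y n \<in> S" "\<And>n. (dist x (Y n))\<^sup>2 < d\<^sup>2 + 1 / real (Suc n)"
    by metis
  have gap: "(dist y z)\<^sup>2 \<le> 2 * (dist x y)\<^sup>2 + 2 * (dist x z)\<^sup>2 - 4 * d\<^sup>2" if "y \<in> S" "z \<in> S" for y z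
  proof -
    have "(1 / 2) *\<^sub>R (y + z) \<in> S"
      using S(1) that by (intro subspace_scale subspace_add)
    then have "d\<^sup>2 \<le> (dist x ((1 / 2) *\<^sub>R (y + z)))\<^sup>2"
      using d_le d0 by (intro power_mono) auto
    then show ?thesis
      unfolding dist_norm power2_norm_eq_inner
      by (simp add: inner_diff inner_add inner_commute algebra_simps)
  qed
  have "Cauchy Y"
  proof (rule metric_CauchyI)
    fix e :: real
    assume "0 < e"
    then obtain N where N: "4 / e\<^sup>2 < real N"
      using reals_Archimedean2 by blast
    have "dist (Y m) (Y n) < e" if "N \<le> m" "N \<le> n" for m n
    proof -
      have "1 / real (Suc k) < e\<^sup>2 / 4" if "N \<le> k" for k
      proof -
        have "4 / e\<^sup>2 < real (Suc k)"
          using N that by linarith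
        then show ?thesis
          using \<open>0 < e\<close> by (simp add: field_simps)
      qed
      from this[OF that(1)] this[OF that(2)] have "(dist (Y m) (Y n))\<^sup>2 < e\<^sup>2"
        using gap[OF Y(1) Y(1), of m n] Y(2)[of m] Y(2)[of n] by linarith
      then show ?thesis
        by (rule power2_less_imp_less) (use \<open>0 < e\<close> in simp)
    qed
    then show "\<exists>N. \<forall>m\<ge>N. \<forall>n\<ge>N. dist (Y m) (Y n) < e"
      by blast
  qed
  then obtain y where y: "Y \<longlonglongrightarrow> y"
    using Cauchy_convergent convergent_def by blast
  then have "y \<in> S"
    using S(2) Y(1) closed_sequentially by blast
  have le: "(dist x y)\<^sup>2 \<le> d\<^sup>2 + 0"
  proof (rule LIMSEQ_le)
    show "(\<lambda>n. (dist x (Y n))\<^sup>2) \<longlonglongrightarrow> (dist x y)\<^sup>2"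
      using y by (intro tendsto_intros)
    show "(\<lambda>n. d\<^sup>2 + 1 / real (Suc n)) \<longlonglongrightarrow> d\<^sup>2 + 0"
      by (intro tendsto_add tendsto_const LIMSEQ_Suc[OF lim_1_over_n])
    show "\<exists>N. \<forall>n\<ge>N. (dist x (Y n))\<^sup>2 \<le> d\<^sup>2 + 1 / real (Suc n)"
      using Y(2) less_imp_le by blast
  qed
  have "dist x y \<le> d"
    by (rule power2_le_imp_le) (use le d0 in simp_all)
  with \<open>y \<in> S\<close> d_le show ?thesis
    by (meson order_trans)
qed

text \<open>If \<open>x - y\<close> had a component along \<open>h\<close>, moving \<open>y\<close> by that component would bring it closer
  to \<open>x\<close>.\<close>

lemma closest_point_inner_eq_zero:
  fixes S :: "'a :: real_inner set"
  assumes "subspace S" "y \<in> S" "\<And>z. z \<in> S \<Longrightarrow> dist x y \<le> dist x z" "h \<in> S"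
  shows "inner (x - y) h = 0"
proof (cases "h = 0")
  case False
  then have hh: "0 < inner h h"
    by simp
  define t where "t = inner (x - y) h / inner h h"
  have "y + t *\<^sub>R h \<in> S"
    using assms by (intro subspace_add subspace_scale)
  then have "(dist x y)\<^sup>2 \<le> (dist x (y + t *\<^sub>R h))\<^sup>2"
    using assms(3) by (intro power_mono) auto
  also have "\<dots> = inner ((x - y) - t *\<^sub>R h) ((x - y) - t *\<^sub>R h)"
    unfolding dist_norm power2_norm_eq_inner by (simp add: diff_diff_eq)
  also have "\<dots> = (dist x y)\<^sup>2 - 2 * t * inner (x - y) h + t * t * inner h h"
    unfolding dist_norm power2_norm_eq_inner
    by (simp add: inner_diff_left inner_diff_right inner_commute algebra_simps)
  also have "t * t * inner h h = t * inner (x - y) h"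
    using hh by (simp add: t_def)
  finally have "t * inner (x - y) h \<le> 0"
    by simp
  then have "(inner (x - y) h)\<^sup>2 \<le> 0"
    using hh by (simp add: t_def power2_eq_square divide_le_0_iff)
  then show ?thesis
    by simp
qed simp

text \<open>The closest point in a complex subspace is also orthogonal in the complex sense: testing real
  orthogonality against \<open>\<i> h\<close> gives the imaginary part of the inner product with \<open>h\<close>.\<close>

lemma orthogonal_decomposition:
  assumes S: "csubspace S" "closed S"
  obtains y where "y \<in> S" "\<And>h. h \<in> S \<Longrightarrow> cinner (x - y) h = 0"
proof -
  have sub: "subspace S"
    using S(1) by (rule csubspace_imp_subspace)
  then obtain y where y: "y \<in> S" "\<And>z. z \<in> S \<Longrightarrow> dist x y \<le> dist x z"
    using exists_closest_point S(2) by blast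
  have re: "Re (cinner (x - y) h) = 0" if "h \<in> S" for h
    using closest_point_inner_eq_zero[OF sub y that] by (simp add: inner_torus_L2_def)
  have "cinner (x - y) h = 0" if "h \<in> S" for h
  proof -
    have "\<i> *\<^sub>C h \<in> S"
      using S(1) that by (rule cvec.subspace_scale)
    from re[OF this] re[OF that] show ?thesis
      by (simp add: complex_eq_iff cinner_scaleC_right)
  qed
  with y(1) that show ?thesis
    by blast
qed

section \<open>Orthogonality conditions in infinite dimension\<close>

text \<open>A single linear equation lowers the dimension by at most one: any \<open>e \<in> E\<close> violating it spans,
  together with the solutions, all of \<open>E\<close>.\<close>

lemma not_cfinite_dimensional_orthogonal:
  assumes "csubspace E" "\<not> cfinite_dimensional E"
  shows "\<not> cfinite_dimensional (E \<inter> {f. cinner f g = 0})"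
proof
  assume "cfinite_dimensional (E \<inter> {f. cinner f g = 0})"
  then obtain b where b: "finite b" "E \<inter> {f. cinner f g = 0} \<subseteq> cspan b"
    by (auto simp: cfinite_dimensional_def)
  have "\<not> E \<subseteq> {f. cinner f g = 0}"
    using assms(2) b unfolding cfinite_dimensional_def by blast
  then obtain e where e: "e \<in> E" "cinner e g \<noteq> 0"
    by blast
  have "E \<subseteq> cspan (insert e b)"
  proof
    fix f
    assume "f \<in> E"
    define c where "c = cinner f g / cinner e g"
    have "f - c *\<^sub>C e \<in> E"
      using assms(1) \<open>f \<in> E\<close> e(1)
      by (intro cvec.subspace_diff cvec.subspace_scale)
    moreover have "cinner (f - c *\<^sub>C e) g = 0"
      using e(2) by (simp add: c_def cinner_diff_left cinner_scaleC_left)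
    ultimately have "f - c *\<^sub>C e \<in> cspan b"
      using b(2) by blast
    then show "f \<in> cspan (insert e b)"
      unfolding cvec.span_insert by blast
  qed
  with assms(2) b(1) show False
    by (auto simp: cfinite_dimensional_def)
qed

lemma exists_nonzero_orthogonal:
  assumes "finite b" "csubspace E" "\<not> cfinite_dimensional E"
  obtains g where "g \<in> E" "g \<noteq> 0" "\<And>h. h \<in> b \<Longrightarrow> cinner g h = 0"
proof -
  have "\<not> cfinite_dimensional (E \<inter> {g. \<forall>h\<in>b. cinner g h = 0})"
    using assms
  proof (induction b arbitrary: E rule: finite_induct)
    case empty
    then show ?case by simp
  next
    case (insert x b)
    have "csubspace (E \<inter> {g. cinner g x = 0})"
      using insert.prems(1) csubspace_orthogonal
      by (rule cvec.subspace_inter)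
    then have "\<not> cfinite_dimensional
        (E \<inter> {g. cinner g x = 0} \<inter> {g. \<forall>h\<in>b. cinner g h = 0})"
      using insert by (intro insert.IH not_cfinite_dimensional_orthogonal)
    moreover have "E \<inter> {g. cinner g x = 0} \<inter> {g. \<forall>h\<in>b. cinner g h = 0}
        = E \<inter> {g. \<forall>h\<in>insert x b. cinner g h = 0}"
      by blast
    ultimately show ?case
      by simp
  qed
  then have "\<not> E \<inter> {g. \<forall>h\<in>b. cinner g h = 0} \<subseteq> cspan {}"
    by (meson cfinite_dimensional_def finite.emptyI)
  then show ?thesis
    using that by auto
qed

lemma csubspace_ominus:
  assumes "csubspace S"
  shows "csubspace (S \<ominus> T)"
  using assms
  by (auto simp: ominus_def cvec.subspace_def cinner_add_left cinner_scaleC_left)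

lemma orthogonal_cspan:
  assumes "f \<in> cspan b" "\<And>h. h \<in> b \<Longrightarrow> cinner g h = 0"
  shows "cinner g f = 0"
proof -
  have "cspan b \<subseteq> {f. cinner f g = 0}"
    using assms(2) csubspace_orthogonal[of g]
    by (intro cvec.span_minimal) (auto simp: cinner_eq_zero_commute)
  with assms(1) show ?thesis
    by (auto simp: cinner_eq_zero_commute)
qed

text \<open>The projection of \<open>g\<close> onto \<open>S\<close> has the same inner products with \<open>S\<close> as \<open>g\<close>. Hence it is
  orthogonal to \<open>T\<close>, lies in \<open>S \<ominus> T\<close>, and is therefore orthogonal to itself.\<close>

lemma orthogonal_if_orthogonal_ominus:
  assumes S: "csubspace S" "closed S"
    and gT: "\<And>h. h \<in> T \<Longrightarrow> cinner g h = 0" and "T \<subseteq> S"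
    and gE: "\<And>h. h \<in> S \<ominus> T \<Longrightarrow> cinner g h = 0"
    and "f \<in> S"
  shows "cinner g f = 0"
proof -
  obtain n where n: "n \<in> S" and r: "\<And>h. h \<in> S \<Longrightarrow> cinner (g - n) h = 0"
    using orthogonal_decomposition[OF S, of g] by blast
  have n_eq: "cinner n h = cinner g h" if "h \<in> S" for h
    using r[OF that] by (simp add: cinner_diff_left)
  have "n \<in> S \<ominus> T"
    using n n_eq gT \<open>T \<subseteq> S\<close> by (auto simp: ominus_def)
  then have "cinner n n = 0"
    using n_eq[OF n] gE by simp
  then have "n = 0"
    by (simp add: cinner_self_eq_zero)
  then show ?thesis
    using n_eq[OF \<open>f \<in> S\<close>] by simp
qed

section \<open>Intermediate invariant subspaces\<close>

text \<open>The image of the smaller subspace lies in \<open>B M\<close>, which is orthogonal to the wandering vector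
  \<open>g\<close>.\<close>

lemma Bergman_invariant_orthogonal:
  assumes M: "Bergman_invariant M" and g: "g \<in> M \<ominus> Bergman_shift ` M"
  shows "Bergman_invariant (M \<inter> {f. cinner f g = 0})"
proof -
  have sub: "csubspace M" and cl: "closed M" and H: "M \<subseteq> H_space" and B: "Bergman_shift ` M \<subseteq> M"
    using M unfolding Bergman_invariant_def by blast+
  have "csubspace (M \<inter> {f. cinner f g = 0})"
    using sub csubspace_orthogonal by (rule cvec.subspace_inter)
  moreover have "closed (M \<inter> {f. cinner f g = 0})"
    using cl closed_orthogonal by (rule closed_Int)
  moreover have "cinner (Bergman_shift f) g = 0" if "f \<in> M" for f
  proof -
    have "cinner g (Bergman_shift f) = 0"
      using g that unfolding ominus_def by blast
    then show ?thesis
      by (rule cinner_eq_zero_commute[THEN iffD1])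
  qed
  ultimately show ?thesis
    using H B unfolding Bergman_invariant_def by blast
qed

theorem theorem2p6:
  fixes M N :: "torus_L2 set"
  assumes "Bergman_invariant M" and "Bergman_invariant N" and "N \<subset> M"
    and "cfinite_dimensional (N \<ominus> Bergman_shift ` N)"
    and "\<not> cfinite_dimensional (M \<ominus> Bergman_shift ` M)"
  shows "\<exists>L. Bergman_invariant L \<and> N \<subset> L \<and> L \<subset> M"
proof -
  let ?E = "M \<ominus> Bergman_shift ` M"
  have M: "csubspace M" and N: "csubspace N" "closed N" "Bergman_shift ` N \<subseteq> N"
    using assms(1,2) unfolding Bergman_invariant_def by blast+
  obtain b where b: "finite b" "N \<ominus> Bergman_shift ` N \<subseteq> cspan b"
    using assms(4) unfolding cfinite_dimensional_def by blast
  have perp_N: "cinner g f = 0"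
    if "g \<in> ?E" "\<And>h. h \<in> b \<Longrightarrow> cinner g h = 0" "f \<in> N" for f g
  proof (rule orthogonal_if_orthogonal_ominus[OF N(1,2) _ N(3) _ that(3)])
    show "cinner g h = 0" if "h \<in> Bergman_shift ` N" for h
      using that \<open>g \<in> ?E\<close> \<open>N \<subset> M\<close> unfolding ominus_def by blast
    show "cinner g h = 0" if "h \<in> N \<ominus> Bergman_shift ` N" for h
      using orthogonal_cspan b(2) that \<open>\<And>h. h \<in> b \<Longrightarrow> cinner g h = 0\<close> by blast
  qed
  have E: "csubspace ?E"
    using M by (rule csubspace_ominus)
  obtain g1 where g1: "g1 \<in> ?E" "g1 \<noteq> 0" "\<And>h. h \<in> b \<Longrightarrow> cinner g1 h = 0"
    using exists_nonzero_orthogonal[OF b(1) E assms(5)] by blast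
  obtain g2 where g2: "g2 \<in> ?E" "g2 \<noteq> 0" "\<And>h. h \<in> insert g1 b \<Longrightarrow> cinner g2 h = 0"
    using exists_nonzero_orthogonal[OF _ E assms(5), of "insert g1 b"] b(1) by blast
  let ?L = "M \<inter> {f. cinner f g1 = 0}"
  have "Bergman_invariant ?L"
    using assms(1) g1(1) by (rule Bergman_invariant_orthogonal)
  moreover have "N \<subseteq> ?L"
    using perp_N[OF g1(1,3)] \<open>N \<subset> M\<close> cinner_eq_zero_commute[of g1] by blast
  moreover have "g2 \<in> ?L" "g2 \<notin> N"
  proof -
    show "g2 \<in> ?L"
      using g2(1) g2(3)[of g1] by (simp add: ominus_def)
    have "cinner g2 f = 0" if "f \<in> N" for f
      by (rule perp_N[OF g2(1) _ that]) (rule g2(3)[OF insertI2])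
    then show "g2 \<notin> N"
      using g2(2) cinner_self_eq_zero by blast
  qed
  moreover have "g1 \<in> M" "g1 \<notin> ?L"
    using g1(1,2) by (auto simp: ominus_def cinner_self_eq_zero)
  ultimately show ?thesis
    by blast
qed

end
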